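(* Let $\mathcal{G}$ be a directed acyclic graph with vertex set $\boldsymbol{V}$, some of whose vertices $\boldsymbol{U}\subset\boldsymbol{V}$ are latent and whose remaining vertices $\boldsymbol{V}\setminus\boldsymbol{U}$ are observable, with all observable variables discrete. Let $P$, with probability mass function $p$ on the observable variables, be any distribution in the observable margin of the model of $\mathcal{G}$. Let $\boldsymbol{A},\boldsymbol{B},\boldsymbol{C},\boldsymbol{D}$ be disjoint sets of observable vertices such that no vertex in $\boldsymbol{C}$ is a descendant in $\mathcal{G}$ of any vertex in $\boldsymbol{D}$. Suppose that $\boldsymbol{A}$ is e-separated from $\boldsymbol{B}$ by $\boldsymbol{C}$ after deletion of $\boldsymbol{D}$ in $\mathcal{G}$. (i) For any fixed value $\boldsymbol{d}$ of $\boldsymbol{D}$, the conditional probabilities $p(\boldsymbol{a},\boldsymbol{b},\boldsymbol{d}\mid\boldsymbol{c})$ are compatible with a distribution under which $\boldsymbol{A}$ is independent of $\boldsymbol{B}$ given $\boldsymbol{C}$. That is, there is a probability distribution $P^*$ (with mass function $p^*$) of $(\boldsymbol{A},\boldsymbol{B},\boldsymbol{C},\boldsymbol{D})$ on the same state spaces such that $\boldsymbol{A}\perp\!\!\!\perp\boldsymbol{B}\mid\boldsymbol{C}\ [P^*]$ and, for all values $\boldsymbol{a},\boldsymbol{b}$ and all $\boldsymbol{c}$ with $p(\boldsymbol{c})>0$, one has $p^*(\boldsymbol{c})>0$ and $p^*(\boldsymbol{a},\boldsymbol{b},\boldsymbol{d}\mid\boldsymbol{c})=p(\boldsymbol{a},\boldsymbol{b},\boldsymbol{d}\mid\boldsymbol{c})$.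 (ii) If in addition no vertex in $\boldsymbol{A}$ is a descendant in $\mathcal{G}$ of any vertex in $\boldsymbol{D}$, then for any fixed value $\boldsymbol{d}$ of $\boldsymbol{D}$ the conditional probabilities $p(\boldsymbol{b},\boldsymbol{d}\mid\boldsymbol{a},\boldsymbol{c})$ are compatible with a distribution under which $\boldsymbol{A}$ is independent of $\boldsymbol{B}$ given $\boldsymbol{C}$. That is, there is a probability distribution $P^*$ of $(\boldsymbol{A},\boldsymbol{B},\boldsymbol{C},\boldsymbol{D})$ on the same state spaces such that $\boldsymbol{A}\perp\!\!\!\perp\boldsymbol{B}\mid\boldsymbol{C}\ [P^*]$ and, for all values $\boldsymbol{b}$ and all $(\boldsymbol{a},\boldsymbol{c})$ with $p(\boldsymbol{a},\boldsymbol{c})>0$, one has $p^*(\boldsymbol{a},\boldsymbol{c})>0$ and $p^*(\boldsymbol{b},\boldsymbol{d}\mid\boldsymbol{a},\boldsymbol{c})=p(\boldsymbol{b},\boldsymbol{d}\mid\boldsymbol{a},\boldsymbol{c})$.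
   Context: Graphs and models. Each vertex of a directed acyclic graph (DAG) $\mathcal{G}$ is identified with a random variable, and a set of vertices with the corresponding random vector. $\mathrm{pa}_{\mathcal{G}}(V)$ is the set of parents of $V$. A vertex $Y$ is a descendant of $X$ (and $X$ an ancestor of $Y$) if there is a directed path from $X$ to $Y$. A joint distribution over $\boldsymbol{V}$ with density $f$ is in the model of $\mathcal{G}$ if $f$ factorizes as $\prod_{V\in\boldsymbol{V}} f(V\mid \mathrm{pa}_{\mathcal{G}}(V))$, a product of conditional densities. The vertices are partitioned into latent vertices $\boldsymbol{U}$ and observable vertices $\boldsymbol{V}\setminus\boldsymbol{U}$. The observable margin of the model consists of the distributions of the observable variables of the form $\int \prod_{V\in\boldsymbol{V}} f(V\mid\mathrm{pa}_{\mathcal{G}}(V))\,d\boldsymbol{U}$. The state spaces of the observable variables are fixed. No assumption is made on the state spaces of the latent variables (they are arbitrary). Standing assumption: no latent vertex has any parents. d-separation. A path is a sequence of adjacent edges (of any orientation) without repeated vertices. An internal vertex of a path at which two arrowheads meet is a collider on the path; other internal vertices are non-colliders. A path is blocked given a vertex set $\boldsymbol{C}$ if it contains a non-collider in $\boldsymbol{C}$, or a collider that is neither in $\boldsymbol{C}$ nor an ancestor of a vertex in $\boldsymbol{C}$. Sets $\boldsymbol{A}$ and $\boldsymbol{B}$ are d-separated by $\boldsymbol{C}$ if every path from a vertex of $\boldsymbol{A}$ to a vertex of $\boldsymbol{B}$ is blocked given $\boldsymbol{C}$. e-separation. For $\boldsymbol{W}\subset\boldsymbol{V}$, $\mathcal{G}_{\boldsymbol{W}}$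 is the induced subgraph on $\boldsymbol{W}$ (vertices $\boldsymbol{W}$, all edges of $\mathcal{G}$ between vertices of $\boldsymbol{W}$). For disjoint sets of observable vertices $\boldsymbol{A},\boldsymbol{B},\boldsymbol{C},\boldsymbol{D}$, $\boldsymbol{A}$ is e-separated from $\boldsymbol{B}$ by $\boldsymbol{C}$ after deletion of $\boldsymbol{D}$ in $\mathcal{G}$ if $\boldsymbol{A}$ and $\boldsymbol{B}$ are d-separated by $\boldsymbol{C}$ in $\mathcal{G}_{\boldsymbol{V}\setminus\boldsymbol{D}}$. Lower-case bold letters denote values of the corresponding random vectors, e.g. $p(\boldsymbol{a},\boldsymbol{b},\boldsymbol{d}\mid\boldsymbol{c})=P(\boldsymbol{A}=\boldsymbol{a},\boldsymbol{B}=\boldsymbol{b},\boldsymbol{D}=\boldsymbol{d}\mid\boldsymbol{C}=\boldsymbol{c})$. "Discrete" means with a finite or countable state space. *)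

theory Defs
  imports "HOL-Probability.Probability"
begin

definition dag :: "'v set \<Rightarrow> ('v \<times> 'v) set \<Rightarrow> bool" where
  "dag V E \<longleftrightarrow> finite V \<and> E \<subseteq> V \<times> V \<and> acyclic E"

definition parents :: "('v \<times> 'v) set \<Rightarrow> 'v \<Rightarrow> 'v set" where
  "parents E v = {w. (w, v) \<in> E}"

definition is_descendant :: "('v \<times> 'v) set \<Rightarrow> 'v \<Rightarrow> 'v \<Rightarrow> bool" where
  "is_descendant E y x \<longleftrightarrow> (x, y) \<in> E\<^sup>+"

(* In an acyclic graph at most one of (x, y), (y, x) is an edge, so a path is determined by its
   vertices. *)

definition is_path :: "'v set \<Rightarrow> ('v \<times> 'v) set \<Rightarrow> 'v list \<Rightarrow> bool" where
  "is_path V E xs \<longleftrightarrow> xs \<noteq> [] \<and> distinct xs \<and> set xs \<subseteq> V \<and>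
     (\<forall>i. Suc i < length xs \<longrightarrow> (xs ! i, xs ! Suc i) \<in> E \<or> (xs ! Suc i, xs ! i) \<in> E)"

definition internal_index :: "'v list \<Rightarrow> nat \<Rightarrow> bool" where
  "internal_index xs i \<longleftrightarrow> 0 < i \<and> Suc i < length xs"

definition collider_at :: "('v \<times> 'v) set \<Rightarrow> 'v list \<Rightarrow> nat \<Rightarrow> bool" where
  "collider_at E xs i \<longleftrightarrow> internal_index xs i \<and>
     (xs ! (i - 1), xs ! i) \<in> E \<and> (xs ! Suc i, xs ! i) \<in> E"

definition blocked :: "('v \<times> 'v) set \<Rightarrow> 'v set \<Rightarrow> 'v list \<Rightarrow> bool" where
  "blocked E C xs \<longleftrightarrow>
     (\<exists>i. internal_index xs i \<and> \<not> collider_at E xs i \<and> xs ! i \<in> C) \<or>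
     (\<exists>i. collider_at E xs i \<and> xs ! i \<notin> C \<and> \<not> (\<exists>c\<in>C. is_descendant E c (xs ! i)))"

definition d_separated :: "'v set \<Rightarrow> ('v \<times> 'v) set \<Rightarrow> 'v set \<Rightarrow> 'v set \<Rightarrow> 'v set \<Rightarrow> bool" where
  "d_separated V E A B C \<longleftrightarrow>
     (\<forall>xs. is_path V E xs \<and> hd xs \<in> A \<and> last xs \<in> B \<longrightarrow> blocked E C xs)"

definition induced_edges :: "('v \<times> 'v) set \<Rightarrow> 'v set \<Rightarrow> ('v \<times> 'v) set" where
  "induced_edges E W = E \<inter> (W \<times> W)"

definition e_separated ::
  "'v set \<Rightarrow> ('v \<times> 'v) set \<Rightarrow> 'v set \<Rightarrow> 'v set \<Rightarrow> 'v set \<Rightarrow> 'v set \<Rightarrow> bool" where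
  "e_separated V E A B C D \<longleftrightarrow> d_separated (V - D) (induced_edges E (V - D)) A B C"

(* The values of all variables live in one type 'x; the state space of v is the measurable space
   underlying \<mu> v, and \<mu> v itself is the dominating measure for densities. An arbitrary family of
   state spaces fits, by taking 'x to be (a type containing) their disjoint union. In
   conditional_density, k y z is the density at y given that the variables in W have value z. *)

definition conditional_density ::
  "('v \<Rightarrow> 'x measure) \<Rightarrow> 'v \<Rightarrow> 'v set \<Rightarrow> ('x \<Rightarrow> ('v \<Rightarrow> 'x) \<Rightarrow> ennreal) \<Rightarrow> bool" where
  "conditional_density \<mu> v W k \<longleftrightarrow>
     (\<lambda>(y, z). k y z) \<in> borel_measurable (\<mu> v \<Otimes>\<^sub>M PiM W \<mu>) \<and>
     (\<forall>z\<in>space (PiM W \<mu>). (\<integral>\<^sup>+ y. k y z \<partial>\<mu> v) = 1)"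

(* The usual recursive factorization: the k v are normalised kernels. They are then automatically
   versions of the conditional densities, given their parents, of the joint density f. *)

definition in_model ::
  "'v set \<Rightarrow> ('v \<times> 'v) set \<Rightarrow> ('v \<Rightarrow> 'x measure) \<Rightarrow> (('v \<Rightarrow> 'x) \<Rightarrow> ennreal) \<Rightarrow> bool" where
  "in_model V E \<mu> f \<longleftrightarrow>
     (\<exists>k. (\<forall>v\<in>V. conditional_density \<mu> v (parents E v) (k v)) \<and>
          (\<forall>x\<in>space (PiM V \<mu>). f x = (\<Prod>v\<in>V. k v (x v) (restrict x (parents E v)))))"

(* Meant for \<mu> v a counting measure at every observable v, so that a probability mass function
   is a density. *)

definition observable_margin ::
  "'v set \<Rightarrow> 'v set \<Rightarrow> ('v \<times> 'v) set \<Rightarrow> ('v \<Rightarrow> 'x measure) \<Rightarrow> ('v \<Rightarrow> 'x) pmf set" where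
  "observable_margin V U E \<mu> =
     {P. set_pmf P \<subseteq> space (PiM (V - U) \<mu>) \<and>
         (\<exists>f. in_model V E \<mu> f \<and>
              (\<forall>x\<in>space (PiM (V - U) \<mu>).
                 ennreal (pmf P x) = (\<integral>\<^sup>+ u. f (merge (V - U) U (x, u)) \<partial>PiM U \<mu>)))}"

definition takes :: "'v set \<Rightarrow> ('v \<Rightarrow> 'x) \<Rightarrow> ('v \<Rightarrow> 'x) \<Rightarrow> bool" where
  "takes A a x \<longleftrightarrow> (\<forall>v\<in>A. x v = a v)"

definition cond_indep :: "('v \<Rightarrow> 'x) pmf \<Rightarrow> 'v set \<Rightarrow> 'v set \<Rightarrow> 'v set \<Rightarrow> bool" where
  "cond_indep P A B C \<longleftrightarrow>
     (\<forall>a b c. \<P>(x in measure_pmf P. takes C c x) > 0 \<longrightarrow>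
        \<P>(x in measure_pmf P. takes A a x \<and> takes B b x \<bar> takes C c x) =
        \<P>(x in measure_pmf P. takes A a x \<bar> takes C c x) *
        \<P>(x in measure_pmf P. takes B b x \<bar> takes C c x))"

end

theory Submission imports Defs begin

text \<open>
  Fix a value d of D and intervene: in every kernel replace the arguments belonging to D by d. The
  resulting density belongs to the graph in which the edges leaving D are cut, and P* is its margin on
  A, B, C, D. It agrees with the original density where D = d, and on every set of vertices whose
  ancestors avoid D, since those kernels are unchanged. So P* has the required conditional
  probabilities, and it remains to see that A and B are independent given C under P*. After
  integrating out everything outside the ancestral closure W of A, B, C in the graph without D, the
  density is a product over the families \<open>{v} \<union> pa(v)\<close> for v in W. Let L consist of the
  vertices of W outside C that are reachable from A by an active path. By d-separation L misses B, and
  every family either misses L or lies within \<open>L \<union> C\<close>; hence for fixed C the density splits into a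
  function of L times a function of the rest.
\<close>

section \<open>Active paths and ancestral sets\<close>

definition active_path :: "'v set \<Rightarrow> ('v \<times> 'v) set \<Rightarrow> 'v set \<Rightarrow> 'v list \<Rightarrow> bool" where
  "active_path V E C xs \<longleftrightarrow> is_path V E xs \<and> \<not> blocked E C xs"

text \<open>A collider with this property does not block; the reflexive closure merges the two ways
  in which \<open>blocked\<close> lets a collider pass.\<close>

definition opens :: "('v \<times> 'v) set \<Rightarrow> 'v set \<Rightarrow> 'v \<Rightarrow> bool" where
  "opens E C v \<longleftrightarrow> (\<exists>c\<in>C. (v, c) \<in> E\<^sup>*)"

lemma opens_iff: "opens E C v \<longleftrightarrow> v \<in> C \<or> (\<exists>c\<in>C. is_descendant E c v)"
  unfolding opens_def is_descendant_def by (auto simp: rtrancl_eq_or_trancl)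

lemma not_blocked_iff:
  "\<not> blocked E C xs \<longleftrightarrow>
     (\<forall>i. internal_index xs i \<longrightarrow> (if collider_at E xs i then opens E C (xs ! i) else xs ! i \<notin> C))"
  unfolding blocked_def opens_iff by (auto simp: collider_at_def)

text \<open>An internal vertex of a prefix has the same neighbours as in the whole path, and the new
  last vertex is an endpoint, on which no condition is placed.\<close>

lemma active_path_take:
  assumes "active_path V E C xs" "0 < n"
  shows "active_path V E C (take n xs)"
proof -
  have "is_path V E (take n xs)"
    using assms set_take_subset[of n xs] by (fastforce simp: active_path_def is_path_def)
  moreover have "internal_index xs i" "collider_at E (take n xs) i \<longleftrightarrow> collider_at E xs i"
    "take n xs ! i = xs ! i" if "internal_index (take n xs) i" for i
    using that by (auto simp: internal_index_def collider_at_def)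
  ultimately show ?thesis
    using assms by (auto simp: active_path_def not_blocked_iff)
qed

text \<open>Only the former last vertex can become internal, between
  \<open>xs ! (length xs - 2)\<close> and \<open>y\<close>. The last two hypotheses are the
  conditions on it: inside \<open>C\<close> it must be a collider, and as a collider it must be
  open. A path of one vertex gains no internal vertex, hence the guards.\<close>

lemma active_path_snoc:
  assumes xs: "active_path V E C xs" and y: "y \<in> V" "y \<notin> set xs"
    and adj: "(last xs, y) \<in> E \<or> (y, last xs) \<in> E"
    and noncollider: "1 < length xs \<Longrightarrow> last xs \<in> C \<Longrightarrow>
      (xs ! (length xs - 2), last xs) \<in> E \<and> (y, last xs) \<in> E"
    and collider: "1 < length xs \<Longrightarrow> (xs ! (length xs - 2), last xs) \<in> E \<Longrightarrow>
      (y, last xs) \<in> E \<Longrightarrow> opens E C (last xs)"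
  shows "active_path V E C (xs @ [y])"
proof -
  have ne: "xs \<noteq> []" using xs by (simp add: active_path_def is_path_def)
  have lst: "last xs = xs ! (length xs - 1)" using ne by (simp add: last_conv_nth)
  have "is_path V E (xs @ [y])"
    unfolding is_path_def
  proof (intro conjI allI impI)
    fix i assume i: "Suc i < length (xs @ [y])"
    show "((xs @ [y]) ! i, (xs @ [y]) ! Suc i) \<in> E \<or> ((xs @ [y]) ! Suc i, (xs @ [y]) ! i) \<in> E"
    proof (cases "Suc i < length xs")
      case True
      then show ?thesis using xs by (auto simp: active_path_def is_path_def nth_append)
    next
      case False
      then have *: "Suc i = length xs" using i by simp
      then have "xs ! i = last xs" using lst by (metis diff_Suc_1)
      then show ?thesis using adj * by (auto simp: nth_append)
    qed
  qed (use xs y in \<open>auto simp: active_path_def is_path_def\<close>)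
  moreover have "if collider_at E (xs @ [y]) i then opens E C ((xs @ [y]) ! i) else (xs @ [y]) ! i \<notin> C"
    if i: "internal_index (xs @ [y]) i" for i
  proof (cases "Suc i < length xs")
    case True
    then have "internal_index xs i" "collider_at E (xs @ [y]) i \<longleftrightarrow> collider_at E xs i"
      "(xs @ [y]) ! i = xs ! i"
      using i by (auto simp: internal_index_def collider_at_def nth_append)
    then show ?thesis using xs by (auto simp: active_path_def not_blocked_iff)
  next
    case False
    then have *: "Suc i = length xs" "0 < i" using i by (auto simp: internal_index_def)
    then have "length xs - 1 = i" "length xs - 2 = i - 1" by auto
    then have "(xs @ [y]) ! i = last xs" "(xs @ [y]) ! Suc i = y"
      "(xs @ [y]) ! (i - 1) = xs ! (length xs - 2)"
      using lst * by (auto simp: nth_append)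
    then show ?thesis
      using collider noncollider i * by (auto simp: collider_at_def)
  qed
  ultimately show ?thesis by (simp add: active_path_def not_blocked_iff)
qed

section \<open>Reachability from A along active paths\<close>

definition reachable :: "'v set \<Rightarrow> ('v \<times> 'v) set \<Rightarrow> 'v set \<Rightarrow> 'v set \<Rightarrow> 'v \<Rightarrow> bool" where
  "reachable V E C A v \<longleftrightarrow> (\<exists>xs. active_path V E C xs \<and> hd xs \<in> A \<and> last xs = v)"

lemma active_path_prefix:
  assumes "active_path V E C xs" "v \<in> set xs"
  obtains n where "n < length xs" "xs ! n = v" "active_path V E C (take (Suc n) xs)"
    "hd (take (Suc n) xs) = hd xs" "last (take (Suc n) xs) = v"
proof -
  obtain n where n: "n < length xs" "xs ! n = v" using assms(2) by (auto simp: in_set_conv_nth)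
  moreover have "last (take (Suc n) xs) = v" "hd (take (Suc n) xs) = hd xs"
    using n by (auto simp: take_Suc_conv_app_nth hd_append hd_take hd_conv_nth)
  ultimately show ?thesis using that active_path_take[OF assms(1)] by blast
qed

text \<open>Paths may not repeat vertices. When the next vertex to be visited already lies on the
  path, cutting the path there reaches it instead.\<close>

lemma reachable_prefix:
  assumes "active_path V E C xs" "hd xs \<in> A" "v \<in> set xs"
  shows "reachable V E C A v"
  using active_path_prefix[OF assms(1,3)] assms(2) unfolding reachable_def by metis

context
  fixes V :: "'v set" and E :: "('v \<times> 'v) set" and A C :: "'v set"
  assumes dag: "dag V E" and A: "A \<subseteq> V" "A \<inter> C = {}"
begin

lemma edgeD: "(x, y) \<in> E \<Longrightarrow> x \<in> V \<and> y \<in> V \<and> x \<noteq> y \<and> (y, x) \<notin> E"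
  using dag unfolding dag_def acyclic_def by (blast intro: trancl.intros)

lemma no_cycle: "(x, y) \<in> E \<Longrightarrow> (y, x) \<notin> E\<^sup>*"
  using dag unfolding dag_def acyclic_def by (meson rtrancl_into_trancl2)

lemma reachable_start: "a \<in> A \<Longrightarrow> reachable V E C A a"
  unfolding reachable_def active_path_def not_blocked_iff
  by (rule exI[of _ "[a]"]) (use A in \<open>auto simp: is_path_def internal_index_def\<close>)

text \<open>The longer path leaves \<open>u\<close> by an outgoing edge, so \<open>u\<close> is a
  non-collider and only has to avoid \<open>C\<close>.\<close>

lemma reachable_child:
  assumes "reachable V E C A u" "u \<notin> C" "(u, v) \<in> E"
  shows "reachable V E C A v"
proof -
  obtain xs where xs: "active_path V E C xs" "hd xs \<in> A" "last xs = u"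
    using assms(1) by (auto simp: reachable_def)
  show ?thesis
  proof (cases "v \<in> set xs")
    case False
    then have "active_path V E C (xs @ [v])"
      using xs assms edgeD[OF assms(3)] by (intro active_path_snoc) auto
    then show ?thesis using xs unfolding reachable_def
      by (intro exI[of _ "xs @ [v]"]) (auto simp: hd_append active_path_def is_path_def)
  qed (use xs reachable_prefix in auto)
qed

text \<open>A vertex of \<open>C\<close> on the directed path would make \<open>u\<close> open, so
  each step is an instance of \<open>reachable_child\<close>.\<close>

lemma reachable_descendant:
  assumes "(u, v) \<in> E\<^sup>*" "reachable V E C A u" "\<not> opens E C u"
  shows "reachable V E C A v"
  using assms
proof (induction rule: rtrancl_induct)
  case (step y z)
  then have "y \<notin> C" by (auto simp: opens_def)
  then show ?case using step reachable_child by blast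
qed

text \<open>A directed path from \<open>u\<close> to \<open>a\<close>, walked backwards, has no
  colliders, and it avoids \<open>C\<close> because \<open>u\<close> is not open. The last conjunct
  records that its final edge points away from \<open>u\<close>, so that going on to a parent of
  \<open>u\<close> does not make \<open>u\<close> a collider.\<close>

lemma reverse_directed_path:
  assumes "(u, a) \<in> E\<^sup>*" "a \<in> A" "\<not> opens E C u"
  shows "\<exists>xs. active_path V E C xs \<and> hd xs \<in> A \<and> last xs = u \<and> (\<forall>x\<in>set xs. (u, x) \<in> E\<^sup>*) \<and>
    (1 < length xs \<longrightarrow> (last xs, xs ! (length xs - 2)) \<in> E)"
  using assms
proof (induction rule: converse_rtrancl_induct)
  case base
  then show ?case unfolding active_path_def not_blocked_iff
    by (intro exI[of _ "[a]"]) (use A in \<open>auto simp: is_path_def internal_index_def\<close>)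
next
  case (step v u)
  have "\<not> opens E C u" using step by (auto simp: opens_def intro: converse_rtrancl_into_rtrancl)
  then obtain xs where xs: "active_path V E C xs" "hd xs \<in> A" "last xs = u"
      "\<forall>x\<in>set xs. (u, x) \<in> E\<^sup>*" "1 < length xs \<longrightarrow> (last xs, xs ! (length xs - 2)) \<in> E"
    and u: "u \<notin> C"
    using step by (auto simp: opens_def)
  have ne: "xs \<noteq> []" using xs by (simp add: active_path_def is_path_def)
  \<comment> \<open>Every vertex of \<open>xs\<close> is \<open>u\<close> or below it, so
    \<open>v\<close> among them would close a cycle.\<close>
  have "v \<notin> set xs" using xs(4) no_cycle[OF step(1)] by auto
  then have "active_path V E C (xs @ [v])"
    using xs edgeD step(1) u by (intro active_path_snoc) auto
  then show ?case using xs(2,3,4) step(1) ne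
    by (intro exI[of _ "xs @ [v]"])
      (auto simp: hd_append nth_append last_conv_nth intro: converse_rtrancl_into_rtrancl)
qed

text \<open>Entering \<open>u\<close> from \<open>v\<close> may turn \<open>u\<close> into a
  collider. This is harmless if \<open>u\<close> is open; otherwise the path is exchanged for the
  one of \<open>reverse_directed_path\<close>, on which \<open>u\<close> stays a
  non-collider.\<close>

lemma reachable_parent:
  assumes "reachable V E C A u" "u \<notin> C" "(v, u) \<in> E"
    and anc: "opens E C u \<or> (\<exists>a\<in>A. (u, a) \<in> E\<^sup>*)"
  shows "reachable V E C A v"
proof -
  obtain xs where xs: "active_path V E C xs" "hd xs \<in> A" "last xs = u"
    "opens E C u \<or> (1 < length xs \<longrightarrow> (last xs, xs ! (length xs - 2)) \<in> E)"
    using assms(1) anc reverse_directed_path unfolding reachable_def by metis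
  show ?thesis
  proof (cases "v \<in> set xs")
    case False
    then have "active_path V E C (xs @ [v])"
      using xs assms edgeD by (intro active_path_snoc) auto
    then show ?thesis using xs unfolding reachable_def
      by (intro exI[of _ "xs @ [v]"]) (auto simp: hd_append active_path_def is_path_def)
  qed (use xs reachable_prefix in auto)
qed

text \<open>The path goes on through \<open>x\<close> as an open collider. If \<open>x\<close>
  already lies on the path, the path is cut at \<open>x\<close> and continued straight to
  \<open>v\<close>.\<close>

lemma reachable_coparent:
  assumes "reachable V E C A u" "u \<notin> C" "(u, x) \<in> E" "(v, x) \<in> E" "opens E C x"
  shows "reachable V E C A v"
proof -
  obtain xs where xs: "active_path V E C xs" "hd xs \<in> A" "last xs = u"
    using assms(1) by (auto simp: reachable_def)
  have ne: "xs \<noteq> []" using xs by (simp add: active_path_def is_path_def)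
  consider "v \<in> set xs" | "v \<notin> set xs" "x \<notin> set xs" | "v \<notin> set xs" "x \<in> set xs" by blast
  then show ?thesis
  proof cases
    case 1
    then show ?thesis using xs reachable_prefix by auto
  next
    case 2
    have "active_path V E C (xs @ [x])"
      using xs assms 2 edgeD[OF assms(3)] by (intro active_path_snoc) auto
    then have "active_path V E C ((xs @ [x]) @ [v])"
      using xs assms 2 ne edgeD[OF assms(4)]
      by (intro active_path_snoc[of _ _ _ "xs @ [x]"]) (auto simp: nth_append last_conv_nth)
    then show ?thesis using xs ne unfolding reachable_def
      by (intro exI[of _ "(xs @ [x]) @ [v]"]) (auto simp: hd_append)
  next
    case 3
    obtain n where n: "n < length xs" "xs ! n = x" "active_path V E C (take (Suc n) xs)"
      "hd (take (Suc n) xs) = hd xs" "last (take (Suc n) xs) = x"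
      using active_path_prefix[OF xs(1) 3(2)] by blast
    \<comment> \<open>Since \<open>x\<close> is not the last vertex, it is either the first vertex
      of \<open>xs\<close> or internal in it.\<close>
    have "x \<noteq> u" using assms(3) edgeD by blast
    then have "Suc n < length xs" using n xs(3) ne by (metis Suc_lessI diff_Suc_1 last_conv_nth)
    \<comment> \<open>A vertex of C inside an active path is a collider, so the edge entering it points to it.\<close>
    then have "(xs ! (n - 1), x) \<in> E" if "x \<in> C" "0 < n"
      using that n xs(1) unfolding active_path_def not_blocked_iff
      by (metis collider_at_def internal_index_def)
    moreover have "take (Suc n) xs ! (length (take (Suc n) xs) - 2) = xs ! (n - 1)"
      using n(1) by (simp add: min_absorb2)
    moreover have "v \<notin> set (take (Suc n) xs)" using 3(1) by (meson in_set_takeD)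
    ultimately have "active_path V E C (take (Suc n) xs @ [v])"
      using n assms edgeD[OF assms(4)] by (intro active_path_snoc) auto
    then show ?thesis using xs n ne unfolding reachable_def
      by (intro exI[of _ "take (Suc n) xs @ [v]"]) (auto simp: hd_append)
  qed
qed

end

section \<open>Ancestral closures and the splitting given by d-separation\<close>

definition ancestors :: "('v \<times> 'v) set \<Rightarrow> 'v set \<Rightarrow> 'v set" where
  "ancestors E Z = {w. \<exists>z\<in>Z. (w, z) \<in> E\<^sup>*}"

lemma ancestors_superset: "Z \<subseteq> ancestors E Z"
  by (auto simp: ancestors_def)

lemma parents_ancestors: "v \<in> ancestors E Z \<Longrightarrow> parents E v \<subseteq> ancestors E Z"
  by (auto simp: ancestors_def parents_def intro: converse_rtrancl_into_rtrancl)

lemma ancestors_subset: "E \<subseteq> V \<times> V \<Longrightarrow> Z \<subseteq> V \<Longrightarrow> ancestors E Z \<subseteq> V"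
  unfolding ancestors_def by (auto elim: converse_rtranclE)

text \<open>Two members of one family are a vertex and its parent, or two parents of a vertex. If
  both lie outside \<open>C\<close> and one is reachable, the lemmas on children, parents and
  coparents make the other reachable. So a family that meets the reachable part can leave it only
  inside \<open>C\<close>.\<close>

lemma d_separated_split:
  fixes V A B C :: "'v set" and E :: "('v \<times> 'v) set"
  assumes dag: "dag V E" and sub: "A \<subseteq> V" and disj: "A \<inter> C = {}"
    and sep: "d_separated V E A B C"
  obtains L where "A \<subseteq> L" "L \<subseteq> ancestors E (A \<union> B \<union> C)" "B \<inter> L = {}" "C \<inter> L = {}"
    "\<And>x. x \<in> ancestors E (A \<union> B \<union> C) \<Longrightarrow>
      insert x (parents E x) \<inter> L = {} \<or> insert x (parents E x) \<subseteq> L \<union> C"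
proof -
  define W where "W = ancestors E (A \<union> B \<union> C)"
  define L where "L = {v \<in> W. v \<notin> C \<and> reachable V E C A v}"
  note reach = reachable_start[OF dag sub disj] reachable_child[OF dag sub disj]
    reachable_descendant[OF dag sub disj] reachable_parent[OF dag sub disj]
    reachable_coparent[OF dag sub disj]
  have not_B: "\<not> reachable V E C A b" if "b \<in> B" for b
    using sep that unfolding d_separated_def reachable_def active_path_def by blast
  \<comment> \<open>A vertex of \<open>W\<close> lies above \<open>A\<close>, \<open>B\<close> or
    \<open>C\<close>, or in them. If it led only to \<open>B\<close>, it would not be open, and
    \<open>reachable_descendant\<close> would reach a vertex of \<open>B\<close>.\<close>
  have anc: "opens E C u \<or> (\<exists>a\<in>A. (u, a) \<in> E\<^sup>*)" if "u \<in> W" "reachable V E C A u" for u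
    using that not_B reach(3) unfolding W_def ancestors_def opens_def by blast
  have "reachable V E C A v"
    if x: "x \<in> W" and u: "u \<in> insert x (parents E x)" "reachable V E C A u" "u \<notin> C"
      and v: "v \<in> insert x (parents E x)" "v \<notin> C" for x u v
  proof -
    have par: "reachable V E C A w" if "reachable V E C A x" "x \<notin> C" "(w, x) \<in> E" for w
      using reach(4) that anc x by blast
    consider "u = x" "v = x" | "u = x" "(v, x) \<in> E" | "(u, x) \<in> E" "v = x"
      | "(u, x) \<in> E" "(v, x) \<in> E"
      using u v by (auto simp: parents_def)
    then show ?thesis
    proof cases
      case 1
      then show ?thesis using u by simp
    next
      case 2
      then show ?thesis using par u by blast
    next
      case 3
      then show ?thesis using reach(2) u by blast
    next
      case 4
      \<comment> \<open>With \<open>x\<close> open, the collider step leads from \<open>u\<close> to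
        \<open>v\<close>. Otherwise \<open>x\<close> is outside \<open>C\<close>, and the route goes
        down to \<open>x\<close> and then up to \<open>v\<close>.\<close>
      then show ?thesis
      proof (cases "opens E C x")
        case False
        then have "x \<notin> C" by (auto simp: opens_def)
        then show ?thesis using par reach(2) u 4 by blast
      qed (use reach(5) u v 4 in blast)
    qed
  qed
  moreover have "insert x (parents E x) \<subseteq> W" if "x \<in> W" for x
    using that parents_ancestors[of x E "A \<union> B \<union> C"] unfolding W_def by auto
  ultimately have "insert x (parents E x) \<inter> L = {} \<or> insert x (parents E x) \<subseteq> L \<union> C"
    if "x \<in> W" for x
    using that unfolding L_def by blast
  moreover have "A \<subseteq> L"
    using reach(1) disj ancestors_superset[of "A \<union> B \<union> C" E] unfolding L_def W_def by blast
  moreover have "B \<inter> L = {}" using not_B by (auto simp: L_def)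
  ultimately show ?thesis using that[of L] unfolding W_def L_def by blast
qed

section \<open>Recursively factorizing densities\<close>

text \<open>Observable and latent vertices are treated alike here. The densities before and after
  the intervention are two instances, so each fact below serves both.\<close>

locale dag_density = product_sigma_finite M for M :: "'v \<Rightarrow> 'x measure" +
  fixes V :: "'v set" and E :: "('v \<times> 'v) set" and k :: "'v \<Rightarrow> 'x \<Rightarrow> ('v \<Rightarrow> 'x) \<Rightarrow> ennreal"
  assumes dag: "dag V E"
    and kernel: "v \<in> V \<Longrightarrow> conditional_density M v (parents E v) (k v)"
begin

definition factor :: "'v \<Rightarrow> ('v \<Rightarrow> 'x) \<Rightarrow> ennreal" where
  "factor v x = k v (x v) (restrict x (parents E v))"

definition joint :: "('v \<Rightarrow> 'x) measure" where
  "joint = density (PiM V M) (\<lambda>x. \<Prod>v\<in>V. factor v x)"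

definition ancestral :: "'v set \<Rightarrow> bool" where
  "ancestral W \<longleftrightarrow> W \<subseteq> V \<and> (\<forall>v\<in>W. parents E v \<subseteq> W)"

lemma finite_V: "finite V"
  using dag by (simp add: dag_def)

lemma ancestral_V: "ancestral V"
  using dag by (auto simp: ancestral_def dag_def parents_def)

lemma factor_cong: "(\<And>w. w \<in> insert v (parents E v) \<Longrightarrow> x w = y w) \<Longrightarrow> factor v x = factor v y"
  unfolding factor_def by (auto intro!: arg_cong2[where f = "k v"] restrict_ext)

lemma factor_restrict:
  "insert v (parents E v) \<subseteq> W \<Longrightarrow> factor v (restrict x W) = factor v x"
  by (rule factor_cong) auto

lemma factor_measurable:
  assumes "v \<in> V" "insert v (parents E v) \<subseteq> W"
  shows "factor v \<in> borel_measurable (PiM W M)"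
proof -
  have k: "(\<lambda>(y, z). k v y z) \<in> borel_measurable (M v \<Otimes>\<^sub>M PiM (parents E v) M)"
    using kernel[OF assms(1)] by (simp add: conditional_density_def)
  have "(\<lambda>x. (x v, restrict x (parents E v))) \<in> measurable (PiM W M) (M v \<Otimes>\<^sub>M PiM (parents E v) M)"
    using assms(2) by (intro measurable_Pair measurable_component_singleton measurable_restrict_subset) auto
  from measurable_compose[OF this k] show ?thesis
    by (simp add: factor_def[abs_def])
qed

lemma ancestral_factor_measurable:
  "ancestral W \<Longrightarrow> v \<in> W \<Longrightarrow> factor v \<in> borel_measurable (PiM W M)"
  by (intro factor_measurable) (auto simp: ancestral_def)

text \<open>\<open>v\<close> is not its own parent, so varying its value leaves the conditioning
  argument of the kernel fixed, and the kernel integrates to 1. The constant \<open>c\<close> is the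
  part of an integrand that does not involve \<open>v\<close>.\<close>

lemma nn_integral_factor_update:
  assumes v: "v \<in> V" "v \<notin> W" "parents E v \<subseteq> W" and x: "x \<in> space (PiM W M)"
  shows "(\<integral>\<^sup>+ y. factor v (x(v := y)) * c \<partial>M v) = c"
proof -
  let ?z = "restrict x (parents E v)"
  have z: "?z \<in> space (PiM (parents E v) M)" using x v(3) by (auto simp: space_PiM)
  have k: "(\<lambda>(y, z). k v y z) \<in> borel_measurable (M v \<Otimes>\<^sub>M PiM (parents E v) M)"
    and 1: "(\<integral>\<^sup>+ y. k v y ?z \<partial>M v) = 1"
    using kernel[OF v(1)] z by (auto simp: conditional_density_def)
  have "restrict (x(v := y)) (parents E v) = ?z" for y
    using v by (intro restrict_ext) auto
  then have "factor v (x(v := y)) = k v y ?z" for y by (simp add: factor_def)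
  moreover have "(\<lambda>y. k v y ?z) \<in> borel_measurable (M v)"
    using measurable_compose[OF measurable_Pair2'[OF z] k] by simp
  ultimately show ?thesis using 1 by (simp add: nn_integral_multc)
qed

text \<open>The vertices outside \<open>W\<close> are integrated out one at a time, each
  contributing 1. The induction runs by enlarging \<open>W\<close>: a vertex \<open>v\<close> whose
  parents all lie in \<open>W\<close> is added, the larger set is covered by the hypothesis, and
  \<open>v\<close> is then integrated out. As \<open>W\<close> is closed under parents, only the
  factor of \<open>v\<close> itself depends on its value.\<close>

lemma nn_integral_ancestral:
  assumes "ancestral W" "g \<in> borel_measurable (PiM W M)"
  shows "(\<integral>\<^sup>+ x. (\<Prod>v\<in>V. factor v x) * g (restrict x W) \<partial>PiM V M) =
    (\<integral>\<^sup>+ x. (\<Prod>v\<in>W. factor v x) * g x \<partial>PiM W M)"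
  using assms
proof (induction "card (V - W)" arbitrary: W g rule: less_induct)
  case (less W g)
  have W: "W \<subseteq> V" "finite W" using less(2) finite_V finite_subset by (auto simp: ancestral_def)
  show ?case
  proof (cases "V \<subseteq> W")
    case True
    then have "V = W" using W by simp
    then show ?thesis by (auto intro!: nn_integral_cong simp: space_PiM PiE_restrict)
  next
    case False
    have "wf E" using dag finite_acyclic_wf finite_subset by (auto simp: dag_def)
    then obtain v where v: "v \<in> V - W" and min: "\<And>w. (w, v) \<in> E \<Longrightarrow> w \<notin> V - W"
      using False by (meson DiffI subsetI wfE_min)
    have pa: "parents E v \<subseteq> W" using ancestral_V v min by (auto simp: ancestral_def parents_def)
    define W' where "W' = insert v W"
    have W': "ancestral W'" using less(2) v pa by (auto simp: W'_def ancestral_def)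
    have "W \<subseteq> W'" by (auto simp: W'_def)
    have g: "(\<lambda>x. g (restrict x W)) \<in> borel_measurable (PiM W' M)"
      using measurable_compose[OF measurable_restrict_subset[OF \<open>W \<subseteq> W'\<close>] less(3)] .
    have mono: "card (V - W') < card (V - W)"
      using v finite_V by (intro psubset_card_mono) (auto simp: W'_def)
    have meas: "(\<lambda>x. (\<Prod>v\<in>W'. factor v x) * g (restrict x W)) \<in> borel_measurable (PiM W' M)"
      using g ancestral_factor_measurable[OF W']
      by (intro borel_measurable_times_ennreal borel_measurable_prod_ennreal) auto
    \<comment> \<open>Restricting to \<open>W'\<close> first presents the integrand in the shape
      that the hypothesis for \<open>W'\<close> expects.\<close>
    have "(\<integral>\<^sup>+ x. (\<Prod>v\<in>V. factor v x) * g (restrict x W) \<partial>PiM V M) =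
        (\<integral>\<^sup>+ x. (\<Prod>v\<in>V. factor v x) * g (restrict (restrict x W') W) \<partial>PiM V M)"
      using \<open>W \<subseteq> W'\<close> by (simp add: Int_absorb1)
    also have "\<dots> = (\<integral>\<^sup>+ x. (\<Prod>v\<in>W'. factor v x) * g (restrict x W) \<partial>PiM W' M)"
      by (rule less(1)[OF mono W' g])
    also have "\<dots> = (\<integral>\<^sup>+ x. (\<integral>\<^sup>+ y. (\<Prod>w\<in>W'. factor w (x(v := y))) * g (restrict (x(v := y)) W) \<partial>M v) \<partial>PiM W M)"
      using product_nn_integral_insert[of W v, OF _ _ meas[unfolded W'_def]] v W(2) by (simp add: W'_def)
    also have "\<dots> = (\<integral>\<^sup>+ x. (\<Prod>v\<in>W. factor v x) * g x \<partial>PiM W M)"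
    proof (rule nn_integral_cong)
      fix x assume x: "x \<in> space (PiM W M)"
      have "restrict (x(v := y)) W = x" for y
        using x v by (auto simp: space_PiM restrict_def fun_eq_iff PiE_def extensional_def)
      moreover have "factor w (x(v := y)) = factor w x" if "w \<in> W" for w y
        using that v less(2) by (intro factor_cong) (auto simp: ancestral_def)
      ultimately have "(\<Prod>w\<in>W'. factor w (x(v := y))) * g (restrict (x(v := y)) W) =
          factor v (x(v := y)) * ((\<Prod>w\<in>W. factor w x) * g x)" for y
        using v W(2) by (simp add: W'_def mult_ac)
      then show "(\<integral>\<^sup>+ y. (\<Prod>w\<in>W'. factor w (x(v := y))) * g (restrict (x(v := y)) W) \<partial>M v) =
          (\<Prod>w\<in>W. factor w x) * g x"
        using nn_integral_factor_update[OF _ _ pa x] v by simp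
    qed
    finally show ?thesis .
  qed
qed

lemma sets_joint[simp]: "sets joint = sets (PiM V M)" and space_joint[simp]: "space joint = space (PiM V M)"
  by (simp_all add: joint_def)

lemma joint_measurable: "(\<lambda>x. \<Prod>v\<in>V. factor v x) \<in> borel_measurable (PiM V M)"
  by (intro borel_measurable_prod_ennreal ancestral_factor_measurable ancestral_V)

lemma emeasure_joint:
  assumes W: "ancestral W" and p: "{x \<in> space (PiM W M). p x} \<in> sets (PiM W M)"
  shows "emeasure joint {x \<in> space (PiM V M). p (restrict x W)} =
    (\<integral>\<^sup>+ x. (\<Prod>v\<in>W. factor v x) * indicator {x. p x} x \<partial>PiM W M)"
proof -
  have WV: "W \<subseteq> V" using W by (simp add: ancestral_def)
  let ?X = "{x \<in> space (PiM V M). p (restrict x W)}"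
  have r: "(\<lambda>x. restrict x W) \<in> measurable (PiM V M) (PiM W M)"
    by (rule measurable_restrict_subset[OF WV])
  have "?X = (\<lambda>x. restrict x W) -` {x \<in> space (PiM W M). p x} \<inter> space (PiM V M)"
    using measurable_space[OF r] by auto
  then have X: "?X \<in> sets (PiM V M)" using measurable_sets[OF r p] by simp
  have "emeasure joint ?X = (\<integral>\<^sup>+ x. (\<Prod>v\<in>V. factor v x) * indicator ?X x \<partial>PiM V M)"
    unfolding joint_def by (rule emeasure_density[OF joint_measurable X])
  also have "\<dots> = (\<integral>\<^sup>+ x. (\<Prod>v\<in>V. factor v x) *
      indicator {x \<in> space (PiM W M). p x} (restrict x W) \<partial>PiM V M)"
    using measurable_space[OF r] by (intro nn_integral_cong) (auto simp: indicator_def)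
  also have "\<dots> = (\<integral>\<^sup>+ x. (\<Prod>v\<in>W. factor v x) * indicator {x \<in> space (PiM W M). p x} x \<partial>PiM W M)"
    using p by (intro nn_integral_ancestral[OF W]) auto
  also have "\<dots> = (\<integral>\<^sup>+ x. (\<Prod>v\<in>W. factor v x) * indicator {x. p x} x \<partial>PiM W M)"
    by (intro nn_integral_cong) (auto simp: indicator_def)
  finally show ?thesis .
qed

text \<open>The empty set is ancestral, so integrating out every vertex leaves the integral of 1
  over a one-point space.\<close>

lemma prob_space_joint: "prob_space joint"
proof
  show "emeasure joint (space joint) = 1"
    using emeasure_joint[of "{}" "\<lambda>_. True"]
    by (simp add: ancestral_def PiM_empty nn_integral_count_space_finite)
qed

end

section \<open>Events that fix values, and independence from a factorization\<close>

lemma takes_measurable: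
  assumes "finite T" "T \<subseteq> W" "\<And>v. v \<in> T \<Longrightarrow> {t v} \<inter> space (M v) \<in> sets (M v)"
  shows "{x \<in> space (PiM W M). takes T t x} \<in> sets (PiM W M)"
  unfolding takes_def
proof (rule sets.sets_Collect_finite_All[OF _ assms(1)])
  fix v assume v: "v \<in> T"
  have c: "(\<lambda>x. x v) \<in> measurable (PiM W M) (M v)"
    using v assms(2) by (intro measurable_component_singleton) auto
  \<comment> \<open>\<open>t v\<close> may lie outside the state space of \<open>v\<close>, hence
    the intersection.\<close>
  have "{x \<in> space (PiM W M). x v = t v} = (\<lambda>x. x v) -` ({t v} \<inter> space (M v)) \<inter> space (PiM W M)"
    using measurable_space[OF c] by auto
  then show "{x \<in> space (PiM W M). x v = t v} \<in> sets (PiM W M)"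
    using measurable_sets[OF c assms(3)[OF v]] by simp
qed

lemma takes_cong: "(\<And>v. v \<in> T \<Longrightarrow> x v = y v) \<Longrightarrow> takes T t x \<longleftrightarrow> takes T t y"
  by (auto simp: takes_def)

lemma takes_restrict: "T \<subseteq> W \<Longrightarrow> takes T t (restrict x W) \<longleftrightarrow> takes T t x"
  by (rule takes_cong) auto

lemma measurable_merge_fixed:
  assumes "x \<in> space (PiM I M)"
  shows "(\<lambda>y. merge I J (x, y)) \<in> measurable (PiM J M) (PiM (I \<union> J) M)"
  using measurable_compose[OF measurable_Pair1'[OF assms] measurable_merge] .

text \<open>The indicator freezes the \<open>C\<close>-coordinates at \<open>c\<close> and
  contributes the mass of that point. What remains is a function of the \<open>L\<close>-coordinates
  times a function of the \<open>R\<close>-coordinates, which Fubini separates.\<close>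

lemma (in product_sigma_finite) nn_integral_split_at_value:
  assumes fin: "finite L" "finite R" "finite C"
    and disj: "L \<inter> R = {}" "C \<inter> L = {}" "C \<inter> R = {}"
    and g: "g \<in> borel_measurable (PiM (C \<union> L) M)" and h: "h \<in> borel_measurable (PiM (C \<union> R) M)"
    and c: "c \<in> space (PiM C M)" "{x \<in> space (PiM C M). takes C c x} \<in> sets (PiM C M)"
      "{x \<in> space (PiM (C \<union> (L \<union> R)) M). takes C c x} \<in> sets (PiM (C \<union> (L \<union> R)) M)"
  shows "(\<integral>\<^sup>+ x. g (restrict x (C \<union> L)) * h (restrict x (C \<union> R)) * indicator {x. takes C c x} x
      \<partial>PiM (C \<union> (L \<union> R)) M) =
    emeasure (PiM C M) {x \<in> space (PiM C M). takes C c x} *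
      ((\<integral>\<^sup>+ l. g (merge C L (c, l)) \<partial>PiM L M) * (\<integral>\<^sup>+ r. h (merge C R (c, r)) \<partial>PiM R M))"
proof -
  let ?W = "C \<union> (L \<union> R)"
  let ?F = "\<lambda>x. g (restrict x (C \<union> L)) * h (restrict x (C \<union> R))"
  have F: "?F \<in> borel_measurable (PiM ?W M)"
    by (intro borel_measurable_times_ennreal measurable_compose[OF measurable_restrict_subset g]
        measurable_compose[OF measurable_restrict_subset h]) auto
  have gc: "(\<lambda>l. g (merge C L (c, l))) \<in> borel_measurable (PiM L M)"
    by (rule measurable_compose[OF measurable_merge_fixed[OF c(1)] g])
  have hc: "(\<lambda>r. h (merge C R (c, r))) \<in> borel_measurable (PiM R M)"
    by (rule measurable_compose[OF measurable_merge_fixed[OF c(1)] h])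
  let ?I = "\<integral>\<^sup>+ y. ?F (merge C (L \<union> R) (c, y)) \<partial>PiM (L \<union> R) M"
  have "(\<integral>\<^sup>+ x. ?F x * indicator {x. takes C c x} x \<partial>PiM ?W M) =
      (\<integral>\<^sup>+ x. ?F x * indicator {x \<in> space (PiM ?W M). takes C c x} x \<partial>PiM ?W M)"
    by (intro nn_integral_cong) (auto simp: indicator_def)
  also have "\<dots> = (\<integral>\<^sup>+ x. \<integral>\<^sup>+ y. ?F (merge C (L \<union> R) (x, y)) *
      indicator {x \<in> space (PiM ?W M). takes C c x} (merge C (L \<union> R) (x, y)) \<partial>PiM (L \<union> R) M \<partial>PiM C M)"
    using fin disj c(3) F by (intro product_nn_integral_fold) auto
  also have "\<dots> = (\<integral>\<^sup>+ x. \<integral>\<^sup>+ y. indicator {x \<in> space (PiM C M). takes C c x} x *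
      ?F (merge C (L \<union> R) (c, y)) \<partial>PiM (L \<union> R) M \<partial>PiM C M)"
  proof (intro nn_integral_cong)
    fix x y assume xy: "x \<in> space (PiM C M)" "y \<in> space (PiM (L \<union> R) M)"
    have CLR: "C \<inter> (L \<union> R) = {}" using disj by auto
    have sp: "merge C (L \<union> R) (x, y) \<in> space (PiM ?W M)"
      using measurable_space[OF measurable_merge_fixed[OF xy(1)] xy(2)] .
    have t: "takes C c (merge C (L \<union> R) (x, y)) \<longleftrightarrow> takes C c x"
      using CLR by (intro takes_cong) auto
    have m: "merge C (L \<union> R) (x, y) = merge C (L \<union> R) (c, y)" if "takes C c x"
      using that by (auto simp: merge_def takes_def fun_eq_iff)
    show "?F (merge C (L \<union> R) (x, y)) *
      indicator {x \<in> space (PiM ?W M). takes C c x} (merge C (L \<union> R) (x, y)) =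
      indicator {x \<in> space (PiM C M). takes C c x} x * ?F (merge C (L \<union> R) (c, y))"
      using sp t m xy(1) by (auto simp: indicator_def)
  qed
  also have "\<dots> = (\<integral>\<^sup>+ x. indicator {x \<in> space (PiM C M). takes C c x} x * ?I \<partial>PiM C M)"
    using measurable_compose[OF measurable_merge_fixed[OF c(1)] F]
    by (intro nn_integral_cong nn_integral_cmult) auto
  also have "\<dots> = emeasure (PiM C M) {x \<in> space (PiM C M). takes C c x} * ?I"
    using c(2) by (subst nn_integral_multc) auto
  also have "?I = (\<integral>\<^sup>+ l. \<integral>\<^sup>+ r. ?F (merge C (L \<union> R) (c, merge L R (l, r))) \<partial>PiM R M \<partial>PiM L M)"
    using fin disj measurable_compose[OF measurable_merge_fixed[OF c(1)] F]
    by (intro product_nn_integral_fold) auto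
  also have "\<dots> = (\<integral>\<^sup>+ l. \<integral>\<^sup>+ r. g (merge C L (c, l)) * h (merge C R (c, r)) \<partial>PiM R M \<partial>PiM L M)"
  proof (intro nn_integral_cong)
    fix l r
    have "restrict (merge C (L \<union> R) (c, merge L R (l, r))) (C \<union> L) = merge C L (c, l)"
      "restrict (merge C (L \<union> R) (c, merge L R (l, r))) (C \<union> R) = merge C R (c, r)"
      using disj by (auto simp: merge_def fun_eq_iff)
    then show "?F (merge C (L \<union> R) (c, merge L R (l, r))) = g (merge C L (c, l)) * h (merge C R (c, r))"
      by simp
  qed
  also have "\<dots> = (\<integral>\<^sup>+ l. g (merge C L (c, l)) \<partial>PiM L M) * (\<integral>\<^sup>+ r. h (merge C R (c, r)) \<partial>PiM R M)"
    using gc hc by (simp add: nn_integral_cmult nn_integral_multc)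
  finally show ?thesis .
qed

text \<open>Conditional independence in cross-multiplied form, free of division. All four
  probabilities are values of one product formula: a constant, times a term for the event on
  \<open>A\<close>, times a term for the event on \<open>B\<close>. The empty set stands for no
  event.\<close>

lemma (in dag_density) joint_cross_product:
  fixes a b c :: "'v \<Rightarrow> 'x"
  assumes W: "ancestral W" and part: "W = C \<union> (L \<union> R)" "L \<inter> R = {}" "C \<inter> L = {}" "C \<inter> R = {}"
    and families: "\<And>v. v \<in> W \<Longrightarrow>
      insert v (parents E v) \<inter> L = {} \<or> insert v (parents E v) \<subseteq> L \<union> C"
    and AB: "A \<subseteq> L" "B \<subseteq> R"
    and meas: "\<And>v t. v \<in> A \<union> B \<union> C \<Longrightarrow> {t} \<inter> space (M v) \<in> sets (M v)"
  defines "p \<equiv> \<lambda>A B. emeasure joint {x \<in> space (PiM V M). takes A a x \<and> takes B b x \<and> takes C c x}"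
  shows "p A B * p {} {} = p A {} * p {} B"
proof (cases "\<exists>x0\<in>space (PiM C M). takes C c x0")
  case False
  have "C \<subseteq> V" using W part by (auto simp: ancestral_def)
  then have "restrict x C \<in> space (PiM C M)" if "x \<in> space (PiM V M)" for x
    using that by (auto simp: space_PiM)
  then have "\<not> takes C c x" if "x \<in> space (PiM V M)" for x
    using that False takes_restrict[of C C c x] by blast
  then have "{x \<in> space (PiM V M). takes A' a x \<and> takes B' b x \<and> takes C c x} = {}" for A' B'
    by blast
  then have "p A' B' = 0" for A' B' unfolding p_def by (simp only: emeasure_empty)
  then show ?thesis by simp
next
  case True
  then obtain x0 where x0: "x0 \<in> space (PiM C M)" "takes C c x0" by blast
  \<comment> \<open>\<open>c\<close> itself need not belong to the product space over
    \<open>C\<close>; \<open>x0\<close> does, and it fixes the same event.\<close>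
  have takes_x0: "takes C c = takes C x0" using x0(2) by (auto simp: takes_def fun_eq_iff)
  have WV: "W \<subseteq> V" using W by (simp add: ancestral_def)
  then have fin: "finite W" using finite_V finite_subset by blast
  \<comment> \<open>Every factor is assigned to one side; families inside \<open>C\<close> alone
    could go to either and are put into \<open>W1\<close>.\<close>
  define W1 where "W1 = {v \<in> W. insert v (parents E v) \<subseteq> L \<union> C}"
  define W2 where "W2 = W - W1"
  \<comment> \<open>Such a family is not inside \<open>L \<union> C\<close>, so it misses
    \<open>L\<close>; by ancestrality it stays in \<open>W\<close>.\<close>
  have fam2: "insert v (parents E v) \<subseteq> C \<union> R" if "v \<in> W2" for v
    using that families[of v] W part unfolding W1_def W2_def ancestral_def by blast
  define g where "g A' x = (\<Prod>v\<in>W1. factor v x) * indicator {x. takes A' a x} x" for A' x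
  define h where "h B' x = (\<Prod>v\<in>W2. factor v x) * indicator {x. takes B' b x} x" for B' x
  have tm: "{x \<in> space (PiM Z M). takes T t x} \<in> sets (PiM Z M)"
    if "T \<subseteq> Z" "T \<subseteq> A \<union> B \<union> C" "T \<subseteq> W" for T Z t
    using that meas finite_subset[OF _ fin] by (intro takes_measurable) auto
  then have ind: "(\<lambda>x. indicator {x. takes T t x} x :: ennreal) \<in> borel_measurable (PiM Z M)"
    if "T \<subseteq> Z" "T \<subseteq> A \<union> B \<union> C" "T \<subseteq> W" for T Z t
    using that by (intro borel_measurable_indicator') simp
  have g: "g A' \<in> borel_measurable (PiM (C \<union> L) M)" if "A' \<subseteq> A" for A'
    unfolding g_def using that AB part WV W1_def
    by (intro borel_measurable_times_ennreal borel_measurable_prod_ennreal factor_measurable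
        ind) auto
  have h: "h B' \<in> borel_measurable (PiM (C \<union> R) M)" if "B' \<subseteq> B" for B'
    unfolding h_def using that AB part WV fam2 W2_def
    by (intro borel_measurable_times_ennreal borel_measurable_prod_ennreal factor_measurable
        ind) auto
  define \<alpha> where "\<alpha> A' = (\<integral>\<^sup>+ l. g A' (merge C L (x0, l)) \<partial>PiM L M)" for A'
  define \<beta> where "\<beta> B' = (\<integral>\<^sup>+ r. h B' (merge C R (x0, r)) \<partial>PiM R M)" for B'
  \<comment> \<open>The first factor does not depend on \<open>A'\<close> and \<open>B'\<close>, so
    both sides of the claim become the same product up to order.\<close>
  have "p A' B' = emeasure (PiM C M) {x \<in> space (PiM C M). takes C c x} * (\<alpha> A' * \<beta> B')"
    if A'B': "A' \<subseteq> A" "B' \<subseteq> B" for A' B'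
  proof -
    have sub: "A' \<subseteq> W" "B' \<subseteq> W" "C \<subseteq> W" "A' \<subseteq> C \<union> L" "B' \<subseteq> C \<union> R" using A'B' AB part by auto
    have "p A' B' = emeasure joint {x \<in> space (PiM V M). takes A' a (restrict x W) \<and>
        takes B' b (restrict x W) \<and> takes C c (restrict x W)}"
      unfolding p_def using sub by (simp add: takes_restrict)
    also have "\<dots> = (\<integral>\<^sup>+ x. (\<Prod>v\<in>W. factor v x) *
        indicator {x. takes A' a x \<and> takes B' b x \<and> takes C c x} x \<partial>PiM W M)"
      using A'B' sub by (intro emeasure_joint[OF W] sets.sets_Collect_conj tm) auto
    also have "\<dots> = (\<integral>\<^sup>+ x. g A' (restrict x (C \<union> L)) * h B' (restrict x (C \<union> R)) *
        indicator {x. takes C x0 x} x \<partial>PiM W M)"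
    proof (rule nn_integral_cong)
      fix x
      have "(\<Prod>v\<in>W. factor v x) = (\<Prod>v\<in>W2. factor v x) * (\<Prod>v\<in>W1. factor v x)"
        unfolding W2_def by (rule prod.subset_diff) (auto simp: W1_def fin)
      moreover have "(\<Prod>v\<in>W1. factor v (restrict x (C \<union> L))) = (\<Prod>v\<in>W1. factor v x)"
        by (intro prod.cong refl factor_restrict) (auto simp: W1_def)
      moreover have "(\<Prod>v\<in>W2. factor v (restrict x (C \<union> R))) = (\<Prod>v\<in>W2. factor v x)"
        by (intro prod.cong refl factor_restrict fam2)
      ultimately show "(\<Prod>v\<in>W. factor v x) * indicator {x. takes A' a x \<and> takes B' b x \<and> takes C c x} x =
          g A' (restrict x (C \<union> L)) * h B' (restrict x (C \<union> R)) * indicator {x. takes C x0 x} x"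
        using sub by (auto simp: g_def h_def takes_restrict takes_x0 indicator_def mult_ac)
    qed
    also have "\<dots> = emeasure (PiM C M) {x \<in> space (PiM C M). takes C x0 x} * (\<alpha> A' * \<beta> B')"
      unfolding part(1) \<alpha>_def \<beta>_def
      using part fin x0 g h A'B' sub by (intro nn_integral_split_at_value tm) auto
    finally show ?thesis by (simp add: takes_x0)
  qed
  then show ?thesis by (simp add: mult_ac)
qed

section \<open>Discrete laws and observable margins\<close>

lemma (in prob_space) ex_pmf_countable_range:
  assumes Y: "countable Y" and f: "f \<in> measurable M (count_space Y)"
  shows "\<exists>Q. set_pmf Q \<subseteq> Y \<and> (\<forall>p. measure Q {x. p x} = prob {x \<in> space M. p (f x)})"
proof -
  \<comment> \<open>A \<open>pmf\<close> lives on the whole type; a set has the same preimage as its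
    part inside \<open>Y\<close>.\<close>
  have f': "f \<in> measurable M (count_space UNIV)"
  proof (rule measurableI)
    fix X :: "'b set"
    have "f -` X \<inter> space M = f -` (X \<inter> Y) \<inter> space M" using measurable_space[OF f] by auto
    then show "f -` X \<inter> space M \<in> sets M" using measurable_sets[OF f, of "X \<inter> Y"] by simp
  qed simp
  let ?D = "distr M (count_space UNIV) f"
  interpret D: prob_space ?D by (rule prob_space_distr[OF f'])
  have ae: "AE x in ?D. x \<in> Y"
    using f' measurable_space[OF f] by (subst AE_distr_iff) auto
  \<comment> \<open>A law concentrated on a countable set gives positive mass to almost every point,
    as \<open>Abs_pmf_inverse\<close> requires.\<close>
  then have "AE x in ?D. measure ?D {x} \<noteq> 0" using D.AE_support_countable Y by auto
  then have Q: "measure_pmf (Abs_pmf ?D) = ?D"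
    using D.prob_space_axioms by (intro Abs_pmf_inverse) auto
  have "measure ?D {x. p x} = prob {x \<in> space M. p (f x)}" for p
    using f' by (subst measure_distr) (auto intro!: arg_cong[where f = prob])
  moreover have "AE x in measure_pmf (Abs_pmf ?D). x \<in> Y" using ae by (simp only: Q)
  then have "set_pmf (Abs_pmf ?D) \<subseteq> Y" by (auto simp: AE_measure_pmf_iff)
  ultimately show ?thesis by (intro exI[of _ "Abs_pmf ?D"]) (simp add: Q)
qed

lemma PiM_count_space_on:
  assumes "finite V'" "\<And>v. v \<in> V' \<Longrightarrow> countable (S v)" "\<And>v. v \<in> V' \<Longrightarrow> M v = count_space (S v)"
  shows "PiM V' M = count_space (PiE V' S)"
proof -
  \<comment> \<open>Empty sets outside \<open>V'\<close> make the family countable at every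
    index.\<close>
  define S' where "S' v = (if v \<in> V' then S v else {})" for v
  have "PiM V' M = PiM V' (\<lambda>v. count_space (S' v))"
    using assms(3) by (intro PiM_cong) (auto simp: S'_def)
  also have "\<dots> = count_space (PiE V' S')"
    using assms by (intro count_space_PiM_finite) (auto simp: S'_def)
  also have "PiE V' S' = PiE V' S" by (auto simp: S'_def intro!: PiE_cong)
  finally show ?thesis .
qed

text \<open>The reference measure on the observable coordinates is counting measure, so summing
  \<open>P\<close> over an event is an integral. Inserting the latent integral for each mass gives,
  by Fubini, an integral of the joint density.\<close>

lemma (in dag_density) measure_pmf_margin:
  assumes part: "V = V' \<union> U" "V' \<inter> U = {}"
    and S: "\<And>v. v \<in> V' \<Longrightarrow> countable (S v)" "\<And>v. v \<in> V' \<Longrightarrow> M v = count_space (S v)"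
    and P: "set_pmf P \<subseteq> PiE V' S"
      "\<And>x. x \<in> PiE V' S \<Longrightarrow>
        ennreal (pmf P x) = (\<integral>\<^sup>+ u. (\<Prod>v\<in>V. factor v (merge V' U (x, u))) \<partial>PiM U M)"
  shows "measure P {x. p x} = measure joint {x \<in> space (PiM V M). p (restrict x V')}"
proof -
  have fin: "finite V'" "finite U" using finite_V part by auto
  have cs: "PiM V' M = count_space (PiE V' S)" by (rule PiM_count_space_on[OF fin(1) S])
  let ?X = "{x \<in> space (PiM V M). p (restrict x V')}"
  have r: "(\<lambda>x. restrict x V') \<in> measurable (PiM V M) (PiM V' M)"
    using part by (intro measurable_restrict_subset) auto
  have "?X = (\<lambda>x. restrict x V') -` {x \<in> PiE V' S. p x} \<inter> space (PiM V M)"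
    using measurable_space[OF r] by (auto simp: cs)
  then have X: "?X \<in> sets (PiM V M)" using measurable_sets[OF r, of "{x \<in> PiE V' S. p x}"] by (simp add: cs)
  have "emeasure P {x. p x} = (\<integral>\<^sup>+ x. indicator {x. p x} x \<partial>measure_pmf P)" by simp
  also have "\<dots> = (\<integral>\<^sup>+ x. ennreal (pmf P x) * indicator {x. p x} x \<partial>count_space UNIV)"
    by (rule nn_integral_measure_pmf)
  also have "\<dots> = (\<integral>\<^sup>+ x. ennreal (pmf P x) * indicator {x. p x} x \<partial>count_space (PiE V' S))"
    using P(1) by (intro nn_integral_count_space_eq) (auto simp: set_pmf_iff)
  also have "\<dots> = (\<integral>\<^sup>+ x. \<integral>\<^sup>+ u. (\<Prod>v\<in>V. factor v (merge V' U (x, u))) * indicator ?X (merge V' U (x, u))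
      \<partial>PiM U M \<partial>PiM V' M)"
    unfolding cs
  proof (intro nn_integral_cong)
    fix x assume "x \<in> space (count_space (PiE V' S))"
    then have x: "x \<in> PiE V' S" "x \<in> space (PiM V' M)" by (simp_all add: cs)
    have "indicator ?X (merge V' U (x, u)) = (indicator {x. p x} x :: ennreal)" if "u \<in> space (PiM U M)" for u
      using measurable_space[OF measurable_merge_fixed[OF x(2)] that] part x
      by (auto simp: indicator_def PiE_restrict)
    moreover have "(\<lambda>u. \<Prod>v\<in>V. factor v (merge V' U (x, u))) \<in> borel_measurable (PiM U M)"
      using measurable_compose[OF measurable_merge_fixed[OF x(2)] joint_measurable[unfolded part(1)]]
      by (simp add: part(1))
    ultimately show "ennreal (pmf P x) * indicator {x. p x} x =
        (\<integral>\<^sup>+ u. (\<Prod>v\<in>V. factor v (merge V' U (x, u))) * indicator ?X (merge V' U (x, u)) \<partial>PiM U M)"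
      using P(2)[OF x(1)] by (simp add: nn_integral_multc cong: nn_integral_cong)
  qed
  also have "\<dots> = (\<integral>\<^sup>+ x. (\<Prod>v\<in>V. factor v x) * indicator ?X x \<partial>PiM V M)"
    using fin part(2) X joint_measurable
      product_nn_integral_fold[of V' U "\<lambda>x. (\<Prod>v\<in>V. factor v x) * indicator ?X x"]
    by (simp add: part(1))
  also have "\<dots> = emeasure joint ?X"
    unfolding joint_def by (rule emeasure_density[OF joint_measurable X, symmetric])
  finally show ?thesis by (simp add: measure_def)
qed

section \<open>Intervention on D\<close>

text \<open>Only what the children of \<open>D\<close> read is replaced by \<open>d\<close>; the
  vertices of \<open>D\<close> are still drawn from kernels of their own and stay random. The new
  kernels are normalised because filling in \<open>d\<close> yields admissible parent
  values.\<close>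

lemma (in dag_density) intervention:
  assumes d: "\<And>w. w \<in> D \<Longrightarrow> d w \<in> space (M w)"
  shows "dag_density M V {(x, y) \<in> E. x \<notin> D}
    (\<lambda>v y z. k v y (\<lambda>w\<in>parents E v. if w \<in> D then d w else z w))"
proof (intro dag_density.intro dag_density_axioms.intro)
  show "product_sigma_finite M" by unfold_locales
  show "dag V {(x, y) \<in> E. x \<notin> D}"
    using dag unfolding dag_def by (blast intro: acyclic_subset)
  fix v assume v: "v \<in> V"
  let ?E = "{(x, y) \<in> E. x \<notin> D}"
  let ?s = "\<lambda>z. \<lambda>w\<in>parents E v. if w \<in> D then d w else z w"
  have s: "?s \<in> measurable (PiM (parents ?E v) M) (PiM (parents E v) M)"
  proof (rule measurable_restrict)
    fix w assume "w \<in> parents E v"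
    then show "(\<lambda>z. if w \<in> D then d w else z w) \<in> measurable (PiM (parents ?E v) M) (M w)"
      using d by (cases "w \<in> D") (auto simp: parents_def intro: measurable_component_singleton)
  qed
  have "(\<lambda>q. (fst q, ?s (snd q))) \<in> measurable (M v \<Otimes>\<^sub>M PiM (parents ?E v) M) (M v \<Otimes>\<^sub>M PiM (parents E v) M)"
    by (intro measurable_Pair measurable_fst measurable_compose[OF measurable_snd s])
  from measurable_compose[OF this, of "\<lambda>(y, z). k v y z" borel]
  show "conditional_density M v (parents ?E v) (\<lambda>y z. k v y (?s z))"
    using kernel[OF v] measurable_space[OF s] by (simp add: conditional_density_def split_beta')
qed

text \<open>\<open>Q\<close> is the law of the four sets after the intervention. Agreement with
  \<open>P\<close> on events with \<open>D = d\<close> supplies the numerators of the conditional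
  probabilities. Agreement on events without \<open>D\<close>, where non-descent enters, supplies
  the denominators for both parts of the theorem.\<close>

lemma (in dag_density) e_separation_compatible:
  assumes V': "V' \<subseteq> V" "\<forall>v\<in>V'. countable (S v)" "\<forall>v\<in>V'. M v = count_space (S v)"
    and P: "\<And>p. measure (measure_pmf P) {x. p x} = measure joint {x \<in> space (PiM V M). p (restrict x V')}"
    and sub: "A \<subseteq> V'" "B \<subseteq> V'" "C \<subseteq> V'" "D \<subseteq> V'"
    and disj: "A \<inter> C = {}" "A \<inter> D = {}" "B \<inter> C = {}" "B \<inter> D = {}" "C \<inter> D = {}"
    and C_D: "\<forall>c\<in>C. \<forall>d\<in>D. \<not> is_descendant E c d"
    and e_sep: "e_separated V E A B C D"
    and d: "d \<in> PiE D S"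
  obtains Q :: "('v \<Rightarrow> 'x) pmf" where "set_pmf Q \<subseteq> PiE (A \<union> B \<union> C \<union> D) S" "cond_indep Q A B C"
    "\<And>a b c. measure (measure_pmf Q) {x. takes A a x \<and> takes B b x \<and> takes C c x \<and> takes D d x} =
      measure (measure_pmf P) {x. takes A a x \<and> takes B b x \<and> takes C c x \<and> takes D d x}"
    "\<And>c. measure (measure_pmf Q) {x. takes C c x} = measure (measure_pmf P) {x. takes C c x}"
    "\<And>a c. \<forall>a\<in>A. \<forall>d\<in>D. \<not> is_descendant E a d \<Longrightarrow>
      measure (measure_pmf Q) {x. takes A a x \<and> takes C c x} =
      measure (measure_pmf P) {x. takes A a x \<and> takes C c x}"
proof -
  let ?E = "{(x, y) \<in> E. x \<notin> D}"
  let ?Z = "A \<union> B \<union> C \<union> D"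
  interpret N: dag_density M V ?E "\<lambda>v y z. k v y (\<lambda>w\<in>parents E v. if w \<in> D then d w else z w)"
    using d sub V'(3) by (intro intervention) (auto simp: PiE_def Pi_def)
  interpret Np: prob_space N.joint by (rule N.prob_space_joint)
  have Z: "?Z \<subseteq> V'" "finite ?Z" "\<And>v. v \<in> ?Z \<Longrightarrow> countable (S v)"
    "\<And>v. v \<in> ?Z \<Longrightarrow> M v = count_space (S v)"
    using sub V' finite_subset[OF _ finite_V] by auto
  have cs: "PiM ?Z M = count_space (PiE ?Z S)" by (rule PiM_count_space_on[OF Z(2-4)])
  have r: "(\<lambda>x. restrict x ?Z) \<in> measurable N.joint (count_space (PiE ?Z S))"
    using measurable_restrict_subset[OF subset_trans[OF Z(1) V'(1)], of M]
    by (simp only: cs measurable_cong_sets[OF N.sets_joint refl])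
  obtain Q where Q: "set_pmf Q \<subseteq> PiE ?Z S"
    "\<And>p. measure (measure_pmf Q) {x. p x} = Np.prob {x \<in> space (PiM V M). p (restrict x ?Z)}"
    using Np.ex_pmf_countable_range[OF _ r] countable_PiE[OF Z(2,3)] by auto
  have meas: "{t} \<inter> space (M v) \<in> sets (M v)" if "v \<in> V'" for v t
    using that V'(3) by auto
  have tm: "{x \<in> space (PiM W M). takes T t x} \<in> sets (PiM W M)" if "T \<subseteq> W" "T \<subseteq> V'" for T W t
    using that meas V'(1) finite_subset[OF _ finite_V] by (intro takes_measurable) auto
  \<comment> \<open>If the parents in \<open>D\<close> already have the values \<open>d\<close>, the
    substitution changes nothing.\<close>
  have factor_N: "N.factor v x = factor v x" if "takes (D \<inter> parents E v) d x" for v x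
    unfolding N.factor_def factor_def using that
    by (auto intro!: arg_cong2[where f = "k v"] restrict_ext simp: takes_def parents_def)

  \<comment> \<open>Hence the two densities coincide pointwise on the event
    \<open>D = d\<close>.\<close>
  have joint_D: "measure N.joint {x \<in> space (PiM V M). q x \<and> takes D d x} =
      measure joint {x \<in> space (PiM V M). q x \<and> takes D d x}"
    if q: "{x \<in> space (PiM V M). q x} \<in> sets (PiM V M)" for q
  proof -
    let ?X = "{x \<in> space (PiM V M). q x \<and> takes D d x}"
    have X: "?X \<in> sets (PiM V M)" using q sub V'(1) by (intro sets.sets_Collect_conj tm) auto
    have eq: "(\<Prod>v\<in>V. N.factor v x) * indicator ?X x = (\<Prod>v\<in>V. factor v x) * indicator ?X x" for x
      by (auto simp: indicator_def takes_def intro!: prod.cong factor_N)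
    have "emeasure N.joint ?X = emeasure joint ?X"
      unfolding N.joint_def joint_def
      by (simp only: emeasure_density[OF N.joint_measurable X] emeasure_density[OF joint_measurable X] eq)
    then show ?thesis by (simp add: measure_def)
  qed
  \<comment> \<open>The ancestors of \<open>T\<close> avoid \<open>D\<close>, so their kernels read
    nothing from \<open>D\<close> and their marginal law is unaffected.\<close>
  have joint_nondescendants: "measure N.joint {x \<in> space (PiM V M). q (restrict x (ancestors E T))} =
      measure joint {x \<in> space (PiM V M). q (restrict x (ancestors E T))}"
    if T: "T \<subseteq> V" "T \<inter> D = {}" "\<And>t d. t \<in> T \<Longrightarrow> d \<in> D \<Longrightarrow> \<not> is_descendant E t d"
      and q: "{x \<in> space (PiM (ancestors E T) M). q x} \<in> sets (PiM (ancestors E T) M)" for q T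
  proof -
    have "ancestors E T \<subseteq> V"
      by (rule ancestors_subset[OF _ T(1)]) (use dag in \<open>simp add: dag_def\<close>)
    then have anc: "ancestral (ancestors E T)"
      by (simp add: ancestral_def parents_ancestors)
    then have anc': "N.ancestral (ancestors E T)"
      unfolding ancestral_def N.ancestral_def by (auto simp: parents_def)
    have "ancestors E T \<inter> D = {}"
      using T(2,3) unfolding ancestors_def is_descendant_def by (auto simp: rtrancl_eq_or_trancl)
    then have "D \<inter> parents E v = {}" if "v \<in> ancestors E T" for v
      using parents_ancestors[OF that] by blast
    then have "(\<Prod>v\<in>ancestors E T. N.factor v x) = (\<Prod>v\<in>ancestors E T. factor v x)" for x
      by (intro prod.cong refl factor_N) (simp add: takes_def)
    then show ?thesis
      using N.emeasure_joint[OF anc' q] emeasure_joint[OF anc q] by (simp add: measure_def)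
  qed

  have "cond_indep Q A B C"
  proof -
    let ?E' = "induced_edges E (V - D)"
    let ?W = "ancestors ?E' (A \<union> B \<union> C)"
    have "dag (V - D) ?E'"
      using dag acyclic_subset[of E ?E'] by (auto simp: dag_def induced_edges_def)
    moreover have "A \<subseteq> V - D" "B \<subseteq> V - D" "C \<subseteq> V - D" using sub V'(1) disj by auto
    ultimately obtain L where L: "A \<subseteq> L" "L \<subseteq> ?W" "B \<inter> L = {}" "C \<inter> L = {}"
      and fam: "\<And>x. x \<in> ?W \<Longrightarrow> insert x (parents ?E' x) \<inter> L = {} \<or> insert x (parents ?E' x) \<subseteq> L \<union> C"
      using d_separated_split[where V = "V - D" and E = ?E' and A = A and B = B and C = C] disj e_sep
      unfolding e_separated_def by metis
    have WV: "?W \<subseteq> V - D"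
      using \<open>A \<subseteq> V - D\<close> \<open>B \<subseteq> V - D\<close> \<open>C \<subseteq> V - D\<close>
      by (intro ancestors_subset) (auto simp: induced_edges_def)
    \<comment> \<open>For a vertex outside \<open>D\<close>, cutting the edges that leave
      \<open>D\<close> and deleting \<open>D\<close> produce the same parents. This carries the
      splitting from the graph without \<open>D\<close> over to the intervened density.\<close>
    have par: "parents ?E v = parents ?E' v" if "v \<in> ?W" for v
      using that WV dag by (auto simp: parents_def induced_edges_def dag_def)
    have W: "N.ancestral ?W"
      unfolding N.ancestral_def using WV par by (auto simp: subsetD[OF parents_ancestors])
    define R where "R = ?W - L - C"
    have Wsup: "A \<union> B \<union> C \<subseteq> ?W" by (rule ancestors_superset)
    have cross: "measure N.joint {x \<in> space (PiM V M). takes A a x \<and> takes B b x \<and> takes C c x} *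
        measure N.joint {x \<in> space (PiM V M). takes C c x} =
        measure N.joint {x \<in> space (PiM V M). takes A a x \<and> takes C c x} *
        measure N.joint {x \<in> space (PiM V M). takes B b x \<and> takes C c x}" for a b c
    proof -
      \<comment> \<open>\<open>takes {}\<close> always holds, so empty sets give the probabilities
        with \<open>A\<close> or \<open>B\<close> left out.\<close>
      have "emeasure N.joint {x \<in> space (PiM V M). takes A a x \<and> takes B b x \<and> takes C c x} *
        emeasure N.joint {x \<in> space (PiM V M). takes {} a x \<and> takes {} b x \<and> takes C c x} =
        emeasure N.joint {x \<in> space (PiM V M). takes A a x \<and> takes {} b x \<and> takes C c x} *
        emeasure N.joint {x \<in> space (PiM V M). takes {} a x \<and> takes B b x \<and> takes C c x}"
      proof (rule N.joint_cross_product[OF W, of C L R])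
        show "?W = C \<union> (L \<union> R)" "L \<inter> R = {}" "C \<inter> L = {}" "C \<inter> R = {}" "A \<subseteq> L" "B \<subseteq> R"
          using L Wsup disj by (auto simp: R_def)
        show "insert v (parents ?E v) \<inter> L = {} \<or> insert v (parents ?E v) \<subseteq> L \<union> C" if "v \<in> ?W" for v
          using fam[OF that] par[OF that] by simp
        show "{t} \<inter> space (M v) \<in> sets (M v)" if "v \<in> A \<union> B \<union> C" for v t
          using that sub by (intro meas) auto
      qed
      then show ?thesis
        by (simp add: takes_def Np.emeasure_eq_measure flip: ennreal_mult)
    qed
    show ?thesis
      unfolding cond_indep_def cond_prob_def
    proof (intro allI impI)
      fix a b c
      assume pos: "0 < measure (measure_pmf Q) {x \<in> space (measure_pmf Q). takes C c x}"
      have sZ: "A \<subseteq> ?Z" "B \<subseteq> ?Z" "C \<subseteq> ?Z" by auto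
      \<comment> \<open>This is \<open>cross\<close> divided by the square of the positive
        probability of \<open>C = c\<close>.\<close>
      show "measure (measure_pmf Q) {x \<in> space (measure_pmf Q). (takes A a x \<and> takes B b x) \<and> takes C c x} /
          measure (measure_pmf Q) {x \<in> space (measure_pmf Q). takes C c x} =
          measure (measure_pmf Q) {x \<in> space (measure_pmf Q). takes A a x \<and> takes C c x} /
          measure (measure_pmf Q) {x \<in> space (measure_pmf Q). takes C c x} *
          (measure (measure_pmf Q) {x \<in> space (measure_pmf Q). takes B b x \<and> takes C c x} /
          measure (measure_pmf Q) {x \<in> space (measure_pmf Q). takes C c x})"
        using cross[of a b c] pos by (simp add: Q(2) takes_restrict sZ field_simps)
    qed
  qed
  moreover have "measure (measure_pmf Q) {x. takes A a x \<and> takes B b x \<and> takes C c x \<and> takes D d x} =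
      measure (measure_pmf P) {x. takes A a x \<and> takes B b x \<and> takes C c x \<and> takes D d x}" for a b c
  proof -
    have "{x \<in> space (PiM V M). takes A a x \<and> takes B b x \<and> takes C c x} \<in> sets (PiM V M)"
      using sub V'(1) by (intro sets.sets_Collect_conj tm) auto
    from joint_D[OF this] show ?thesis
      by (simp add: Q(2) P takes_restrict sub Un_upper1 Un_upper2 le_supI1 le_supI2)
  qed
  moreover have "measure (measure_pmf Q) {x. takes C c x} = measure (measure_pmf P) {x. takes C c x}" for c
  proof -
    have "C \<subseteq> ancestors E C" by (rule ancestors_superset)
    then have "measure N.joint {x \<in> space (PiM V M). takes C c (restrict x (ancestors E C))} =
        measure joint {x \<in> space (PiM V M). takes C c (restrict x (ancestors E C))}"
      using sub V'(1) disj C_D by (intro joint_nondescendants tm) auto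
    then show ?thesis
      using \<open>C \<subseteq> ancestors E C\<close> by (simp add: Q(2) P takes_restrict sub le_supI1 le_supI2)
  qed
  moreover have "measure (measure_pmf Q) {x. takes A a x \<and> takes C c x} =
      measure (measure_pmf P) {x. takes A a x \<and> takes C c x}"
    if A_D: "\<forall>a\<in>A. \<forall>d\<in>D. \<not> is_descendant E a d" for a c
  proof -
    let ?N = "ancestors E (A \<union> C)"
    have AC: "A \<subseteq> ?N" "C \<subseteq> ?N" using ancestors_superset[of "A \<union> C" E] by auto
    then have "measure N.joint {x \<in> space (PiM V M). takes A a (restrict x ?N) \<and> takes C c (restrict x ?N)} =
        measure joint {x \<in> space (PiM V M). takes A a (restrict x ?N) \<and> takes C c (restrict x ?N)}"
      using sub V'(1) disj C_D A_D by (intro joint_nondescendants sets.sets_Collect_conj tm) auto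
    then show ?thesis
      using AC by (simp add: Q(2) P takes_restrict sub le_supI1 le_supI2)
  qed
  ultimately show ?thesis using that[OF Q(1)] by blast
qed

section \<open>From the observable margin to the two compatibility statements\<close>

theorem theorem4p2:
  fixes V U A B C D :: "'v set" and E :: "('v \<times> 'v) set"
    and S :: "'v \<Rightarrow> 'x set" and \<mu> :: "'v \<Rightarrow> 'x measure" and P :: "('v \<Rightarrow> 'x) pmf"
  assumes dag: "dag V E"
    and latent: "U \<subseteq> V" "\<And>u. u \<in> U \<Longrightarrow> parents E u = {}"
    and latent_measure: "\<And>u. u \<in> U \<Longrightarrow> sigma_finite_measure (\<mu> u)"
    and discrete: "\<And>v. v \<in> V - U \<Longrightarrow> countable (S v)"
      "\<And>v. v \<in> V - U \<Longrightarrow> \<mu> v = count_space (S v)"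
    and P: "P \<in> observable_margin V U E \<mu>"
    and observable: "A \<subseteq> V - U" "B \<subseteq> V - U" "C \<subseteq> V - U" "D \<subseteq> V - U"
    and disjoint: "A \<inter> B = {}" "A \<inter> C = {}" "A \<inter> D = {}" "B \<inter> C = {}" "B \<inter> D = {}" "C \<inter> D = {}"
    and C_D: "\<And>c d. c \<in> C \<Longrightarrow> d \<in> D \<Longrightarrow> \<not> is_descendant E c d"
    and e_sep: "e_separated V E A B C D"
  shows
    "(\<forall>d \<in> PiE D S.
        \<exists>Q :: ('v \<Rightarrow> 'x) pmf. set_pmf Q \<subseteq> PiE (A \<union> B \<union> C \<union> D) S \<and> cond_indep Q A B C \<and>
          (\<forall>a \<in> PiE A S. \<forall>b \<in> PiE B S. \<forall>c \<in> PiE C S.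
             \<P>(x in measure_pmf P. takes C c x) > 0 \<longrightarrow>
               \<P>(x in measure_pmf Q. takes C c x) > 0 \<and>
               \<P>(x in measure_pmf Q. takes A a x \<and> takes B b x \<and> takes D d x \<bar> takes C c x) =
               \<P>(x in measure_pmf P. takes A a x \<and> takes B b x \<and> takes D d x \<bar> takes C c x))) \<and>
     ((\<forall>a\<in>A. \<forall>d\<in>D. \<not> is_descendant E a d) \<longrightarrow>
      (\<forall>d \<in> PiE D S.
        \<exists>Q :: ('v \<Rightarrow> 'x) pmf. set_pmf Q \<subseteq> PiE (A \<union> B \<union> C \<union> D) S \<and> cond_indep Q A B C \<and>
          (\<forall>b \<in> PiE B S. \<forall>a \<in> PiE A S. \<forall>c \<in> PiE C S.
             \<P>(x in measure_pmf P. takes A a x \<and> takes C c x) > 0 \<longrightarrow>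
               \<P>(x in measure_pmf Q. takes A a x \<and> takes C c x) > 0 \<and>
               \<P>(x in measure_pmf Q. takes B b x \<and> takes D d x \<bar> takes A a x \<and> takes C c x) =
               \<P>(x in measure_pmf P. takes B b x \<and> takes D d x \<bar> takes A a x \<and> takes C c x))))"
proof -
  obtain f k where P_space: "set_pmf P \<subseteq> space (PiM (V - U) \<mu>)"
    and k: "\<And>v. v \<in> V \<Longrightarrow> conditional_density \<mu> v (parents E v) (k v)"
    and f: "\<And>x. x \<in> space (PiM V \<mu>) \<Longrightarrow> f x = (\<Prod>v\<in>V. k v (x v) (restrict x (parents E v)))"
    and P_f: "\<And>x. x \<in> space (PiM (V - U) \<mu>) \<Longrightarrow>
      ennreal (pmf P x) = (\<integral>\<^sup>+ u. f (merge (V - U) U (x, u)) \<partial>PiM U \<mu>)"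
    using P unfolding observable_margin_def in_model_def by blast
  \<comment> \<open>Nothing is assumed about \<open>\<mu>\<close> outside \<open>V\<close>, whereas \<open>product_sigma_finite\<close> speaks about all indices.\<close>
  define M where "M v = (if v \<in> V then \<mu> v else count_space {})" for v
  have M: "v \<in> V \<Longrightarrow> M v = \<mu> v" for v by (simp add: M_def)
  have PiM_M: "PiM W M = PiM W \<mu>" if "W \<subseteq> V" for W
    using that M by (intro PiM_cong) auto
  have parV: "parents E v \<subseteq> V" for v using dag by (auto simp: dag_def parents_def)
  interpret dag_density M V E k
  proof (intro dag_density.intro product_sigma_finite.intro dag_density_axioms.intro dag)
    show "sigma_finite_measure (M v)" for v
      using latent_measure discrete sigma_finite_measure_count_space_countable[of "{}"]
        sigma_finite_measure_count_space_countable[of "S v"]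
      by (cases "v \<in> U") (auto simp: M_def)
    show "conditional_density M v (parents E v) (k v)" if "v \<in> V" for v
      using k[OF that] by (simp add: conditional_density_def M that PiM_M parV)
  qed
  have obs: "V - U \<subseteq> V" "\<And>v. v \<in> V - U \<Longrightarrow> countable (S v)" "\<And>v. v \<in> V - U \<Longrightarrow> M v = count_space (S v)"
    using discrete by (auto simp: M)
  have cs: "PiM (V - U) M = count_space (PiE (V - U) S)"
    using finite_V by (intro PiM_count_space_on obs) auto
  \<comment> \<open>\<open>P\<close> is the law of the observable coordinates under
    \<open>joint\<close>, the form in which \<open>e_separation_compatible\<close> expects
    it.\<close>
  have margin: "measure (measure_pmf P) {x. p x} = measure joint {x \<in> space (PiM V M). p (restrict x (V - U))}" for p
  proof (rule measure_pmf_margin[of "V - U" U S, OF _ _ obs(2,3)])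
    show "V = V - U \<union> U" "(V - U) \<inter> U = {}" using latent(1) by auto
    show "set_pmf P \<subseteq> PiE (V - U) S" using P_space by (simp flip: PiM_M[OF obs(1)] add: cs)
    fix x assume "x \<in> PiE (V - U) S"
    then have x: "x \<in> space (PiM (V - U) M)" by (simp add: cs)
    have "merge (V - U) U (x, u) \<in> space (PiM V \<mu>)" if "u \<in> space (PiM U \<mu>)" for u
      using measurable_space[OF measurable_merge_fixed[OF x], of u U] that latent(1)
      by (simp add: PiM_M Un_absorb2 Un_Diff_cancel2)
    then show "ennreal (pmf P x) = (\<integral>\<^sup>+ u. (\<Prod>v\<in>V. factor v (merge (V - U) U (x, u))) \<partial>PiM U M)"
      unfolding PiM_M[OF latent(1)]
      using P_f x by (auto simp: f factor_def PiM_M intro!: nn_integral_cong)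
  qed
  have "\<forall>v\<in>V - U. countable (S v)" "\<forall>v\<in>V - U. M v = count_space (S v)"
    "\<forall>c\<in>C. \<forall>d\<in>D. \<not> is_descendant E c d"
    using obs C_D by blast+
  note compatible =
    e_separation_compatible[OF obs(1) this(1,2) margin observable disjoint(2-6) this(3) e_sep]
  show ?thesis
  proof (intro conjI ballI impI)
    fix d assume d: "d \<in> PiE D S"
    obtain Q where Q: "set_pmf Q \<subseteq> PiE (A \<union> B \<union> C \<union> D) S" "cond_indep Q A B C"
      and eq: "\<And>a b c. measure (measure_pmf Q) {x. takes A a x \<and> takes B b x \<and> takes C c x \<and> takes D d x} =
          measure (measure_pmf P) {x. takes A a x \<and> takes B b x \<and> takes C c x \<and> takes D d x}"
        "\<And>c. measure (measure_pmf Q) {x. takes C c x} = measure (measure_pmf P) {x. takes C c x}"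
      by (rule compatible[OF d], rule that)
    \<comment> \<open>The numerators agree because they contain \<open>D = d\<close>, the
      denominators because \<open>C\<close> is not below \<open>D\<close>.\<close>
    have "\<P>(x in measure_pmf Q. takes A a x \<and> takes B b x \<and> takes D d x \<bar> takes C c x) =
        \<P>(x in measure_pmf P. takes A a x \<and> takes B b x \<and> takes D d x \<bar> takes C c x)" for a b c
      using eq(1)[of a b c] eq(2)[of c] by (simp add: cond_prob_def conj_ac)
    then show "\<exists>Q :: ('v \<Rightarrow> 'x) pmf. set_pmf Q \<subseteq> PiE (A \<union> B \<union> C \<union> D) S \<and> cond_indep Q A B C \<and>
          (\<forall>a \<in> PiE A S. \<forall>b \<in> PiE B S. \<forall>c \<in> PiE C S.
             \<P>(x in measure_pmf P. takes C c x) > 0 \<longrightarrow>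
               \<P>(x in measure_pmf Q. takes C c x) > 0 \<and>
               \<P>(x in measure_pmf Q. takes A a x \<and> takes B b x \<and> takes D d x \<bar> takes C c x) =
               \<P>(x in measure_pmf P. takes A a x \<and> takes B b x \<and> takes D d x \<bar> takes C c x))"
      using Q eq(2) by (intro exI[of _ Q]) simp
  next
    fix d assume A_D: "\<forall>a\<in>A. \<forall>d\<in>D. \<not> is_descendant E a d" and d: "d \<in> PiE D S"
    obtain Q where Q: "set_pmf Q \<subseteq> PiE (A \<union> B \<union> C \<union> D) S" "cond_indep Q A B C"
      and eq: "\<And>a b c. measure (measure_pmf Q) {x. takes A a x \<and> takes B b x \<and> takes C c x \<and> takes D d x} =
          measure (measure_pmf P) {x. takes A a x \<and> takes B b x \<and> takes C c x \<and> takes D d x}"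
        "\<And>a c. \<forall>a\<in>A. \<forall>d\<in>D. \<not> is_descendant E a d \<Longrightarrow>
          measure (measure_pmf Q) {x. takes A a x \<and> takes C c x} =
          measure (measure_pmf P) {x. takes A a x \<and> takes C c x}"
      by (rule compatible[OF d], rule that)
    \<comment> \<open>The conditioning event now involves \<open>A\<close> as well; it keeps its
      probability because \<open>A\<close> is not below \<open>D\<close> either.\<close>
    note eq_AC = eq(2)[OF A_D]
    have "\<P>(x in measure_pmf Q. takes B b x \<and> takes D d x \<bar> takes A a x \<and> takes C c x) =
        \<P>(x in measure_pmf P. takes B b x \<and> takes D d x \<bar> takes A a x \<and> takes C c x)" for a b c
      using eq(1)[of a b c] eq_AC[of a c] by (simp add: cond_prob_def conj_ac)
    then show "\<exists>Q :: ('v \<Rightarrow> 'x) pmf. set_pmf Q \<subseteq> PiE (A \<union> B \<union> C \<union> D) S \<and> cond_indep Q A B C \<and>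
          (\<forall>b \<in> PiE B S. \<forall>a \<in> PiE A S. \<forall>c \<in> PiE C S.
             \<P>(x in measure_pmf P. takes A a x \<and> takes C c x) > 0 \<longrightarrow>
               \<P>(x in measure_pmf Q. takes A a x \<and> takes C c x) > 0 \<and>
               \<P>(x in measure_pmf Q. takes B b x \<and> takes D d x \<bar> takes A a x \<and> takes C c x) =
               \<P>(x in measure_pmf P. takes B b x \<and> takes D d x \<bar> takes A a x \<and> takes C c x))"
      using Q eq_AC by (intro exI[of _ Q]) simp
  qed
qed

end
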